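(* Let $u^\varepsilon$ be a solution to $$\begin{cases}\displaystyle u^\varepsilon(x,t)=\inf_{\beta\in[Cb^-,Cb^+]}\frac{1}{|B_\varepsilon(x)|}\int_{B_\varepsilon(x)}u^\varepsilon(y,t-\beta\varepsilon^2)\,dy,&(x,t)\in\Omega\times(0,+\infty),\\ u^\varepsilon(x,t)=0,&(x,t)\in D_\varepsilon\times(-Cb^+\varepsilon^2,+\infty),\\ u^\varepsilon(x,t)=u_0(x),&(x,t)\in\Omega\times[-Cb^+\varepsilon^2,0].\end{cases}$$ Then $u^\varepsilon$ coincides with the value of the game described in the context, that is, for $(x,t)\in\Omega\times(0,+\infty)$, $$u^\varepsilon(x,t)=\inf_S\mathbb{E}_S^{(x,t)}(\mathcal{P}),$$ where the infimum is taken over all strategies $S$ of the player and $\mathcal{P}$ is the final payoff.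
   Context: $\Omega\subset\mathbb{R}^N$, $N\ge1$, is a bounded smooth domain, $b^+>b^->0$, $\varepsilon>0$, $C>0$ is a constant depending only on $N$, and $u_0:\overline\Omega\to\mathbb{R}$ is continuous with $u_0|_{\partial\Omega}=0$. $B_\varepsilon(x)$ is the ball of radius $\varepsilon$ centered at $x$, $B_\varepsilon=B_\varepsilon(0)$, and $D_\varepsilon=(\Omega+B_\varepsilon)\setminus\Omega$. The game: a token starts at $(x_0,t_0)=(x,t)\in\Omega\times(0,\infty)$. At each round, from $(x_k,t_k)$, the player chooses $\beta_k\in[Cb^-,Cb^+]$, the point $x_{k+1}$ is chosen at random with uniform probability in $B_\varepsilon(x_k)$, and $t_{k+1}=t_k-\beta_k\varepsilon^2$. The game ends at the first round $\tau$ at which $x_\tau\notin\Omega$ with $t_\tau>0$, or $t_\tau\le0$. The final payoff is $\mathcal{P}=0$ in the first case and $\mathcal{P}=u_0(x_\tau)$ in the second case (with $u_0$ extended by $0$ outside $\Omega$). A strategy $S$ is a (measurable) rule selecting the value $\beta_k$ at each round, $\beta_k=S(x_k,t_k)$, and $\mathbb{E}_S^{(x,t)}$ is the expectation for the game started at $(x,t)$ and played with strategy $S$. *)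

theory Defs
  imports "HOL-Probability.Probability"
begin

section \<open>Bounded smooth domains\<close>

text \<open>\<open>Ck_on k U f\<close>: the function \<open>f\<close> is of class C^k on the open set \<open>U\<close>.\<close>

primrec Ck_on :: "nat \<Rightarrow> 'a::euclidean_space set \<Rightarrow> ('a \<Rightarrow> real) \<Rightarrow> bool" where
  "Ck_on 0 U f \<longleftrightarrow> continuous_on U f"
| "Ck_on (Suc k) U f \<longleftrightarrow>
     f differentiable_on U \<and> (\<forall>i\<in>Basis. Ck_on k U (\<lambda>x. frechet_derivative f (at x) i))"

text \<open>Smoothness of the boundary is expressed by local defining functions with
  non-vanishing differential. As \<open>\<Omega>\<close> is open, \<open>\<phi> p = 0\<close> at the boundary point \<open>p\<close> is
  automatic, and \<open>\<Omega>\<close> lies locally on one side of its boundary.\<close>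

definition bounded_smooth_domain :: "'a::euclidean_space set \<Rightarrow> bool" where
  "bounded_smooth_domain \<Omega> \<longleftrightarrow>
     open \<Omega> \<and> connected \<Omega> \<and> \<Omega> \<noteq> {} \<and> bounded \<Omega> \<and>
     (\<forall>p\<in>frontier \<Omega>. \<exists>U \<phi>. open U \<and> p \<in> U \<and> (\<forall>k. Ck_on k U \<phi>) \<and>
        (\<forall>x\<in>U. frechet_derivative \<phi> (at x) \<noteq> (\<lambda>_. 0)) \<and>
        \<Omega> \<inter> U = {x\<in>U. \<phi> x < 0})"


section \<open>The dynamic programming equation\<close>

definition outer_strip :: "'a::euclidean_space set \<Rightarrow> real \<Rightarrow> 'a set" where
  "outer_strip \<Omega> \<epsilon> = {x + y |x y. x \<in> \<Omega> \<and> y \<in> ball 0 \<epsilon>} - \<Omega>"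

text \<open>Only values of \<open>u\<close> on \<open>\<Omega> \<union> outer_strip \<Omega> \<epsilon>\<close> at times \<open>\<ge> - (C * bp * \<epsilon>\<^sup>2)\<close> matter.
  No regularity of \<open>u\<close> is imposed. For \<open>0 < bm \<le> bp\<close>, \<open>0 < C\<close>, \<open>0 < \<epsilon>\<close> and \<open>u0\<close> bounded and
  measurable on \<open>\<Omega>\<close>, induction over the time slabs of height \<open>C * bm * \<epsilon>\<^sup>2\<close> shows that every
  solution is bounded by \<open>sup \<bar>u0\<bar>\<close> and Borel measurable in the space variable at each time, so
  the integrals below exist and the infimum is over a bounded set.\<close>

definition DPP_solution ::
  "'a::euclidean_space set \<Rightarrow> real \<Rightarrow> real \<Rightarrow> real \<Rightarrow> real \<Rightarrow> ('a \<Rightarrow> real) \<Rightarrow> ('a \<Rightarrow> real \<Rightarrow> real) \<Rightarrow> bool"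
where
  "DPP_solution \<Omega> bm bp C \<epsilon> u0 u \<longleftrightarrow>
     (\<forall>x\<in>\<Omega>. \<forall>t>0.
        u x t = (INF \<beta>\<in>{C * bm..C * bp}.
                   1 / measure lborel (ball x \<epsilon>) * (LINT y:ball x \<epsilon>|lborel. u y (t - \<beta> * \<epsilon>\<^sup>2)))) \<and>
     (\<forall>x\<in>outer_strip \<Omega> \<epsilon>. \<forall>t>- (C * bp * \<epsilon>\<^sup>2). u x t = 0) \<and>
     (\<forall>x\<in>\<Omega>. \<forall>t\<in>{- (C * bp * \<epsilon>\<^sup>2)..0}. u x t = u0 x)"


section \<open>The game\<close>

text \<open>Strategies are defined on the whole space-time. Their values outside \<open>\<Omega> \<times> (0,\<infinity>)\<close> do
  not influence the payoff, and every measurable rule on \<open>\<Omega> \<times> (0,\<infinity>)\<close> extends.\<close>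

definition strategies :: "real \<Rightarrow> real \<Rightarrow> real \<Rightarrow> ('a::euclidean_space \<times> real \<Rightarrow> real) set" where
  "strategies bm bp C = {S \<in> borel_measurable borel. \<forall>z. S z \<in> {C * bm..C * bp}}"

definition round_law ::
  "real \<Rightarrow> ('a::euclidean_space \<times> real \<Rightarrow> real) \<Rightarrow> 'a \<times> real \<Rightarrow> ('a \<times> real) measure" where
  "round_law \<epsilon> S z =
     distr (uniform_measure lborel (ball (fst z) \<epsilon>)) borel (\<lambda>y. (y, snd z - S z * \<epsilon>\<^sup>2))"

text \<open>Conditional law of the \<open>n\<close>-th position \<open>(x\<^sub>n, t\<^sub>n)\<close> given the history \<open>\<omega>\<close> of positions
  \<open>0, \<dots>, n - 1\<close>. The token keeps moving after the end of the game, which is harmless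
  since the payoff only depends on the trajectory up to the end.\<close>

definition game_kernel ::
  "real \<Rightarrow> ('a::euclidean_space \<times> real \<Rightarrow> real) \<Rightarrow> 'a \<times> real \<Rightarrow>
   nat \<Rightarrow> (nat \<Rightarrow> 'a \<times> real) \<Rightarrow> ('a \<times> real) measure" where
  "game_kernel \<epsilon> S z0 n \<omega> =
     (case n of 0 \<Rightarrow> return borel z0 | Suc k \<Rightarrow> round_law \<epsilon> S (\<omega> k))"

text \<open>The law of the trajectory \<open>k \<mapsto> (x\<^sub>k, t\<^sub>k)\<close>: the measure that the Ionescu-Tulcea theorem
  constructs from these conditional laws (its assumptions are verified below).\<close>

definition game_measure ::
  "real \<Rightarrow> ('a::euclidean_space \<times> real \<Rightarrow> real) \<Rightarrow> 'a \<times> real \<Rightarrow> (nat \<Rightarrow> 'a \<times> real) measure" where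
  "game_measure \<epsilon> S z0 =
     projective_family.lim UNIV (Ionescu_Tulcea.CI (game_kernel \<epsilon> S z0) (\<lambda>_. borel)) (\<lambda>_. borel)"

definition end_round :: "'a::euclidean_space set \<Rightarrow> (nat \<Rightarrow> 'a \<times> real) \<Rightarrow> nat" where
  "end_round \<Omega> \<omega> = (LEAST k. (fst (\<omega> k) \<notin> \<Omega> \<and> snd (\<omega> k) > 0) \<or> snd (\<omega> k) \<le> 0)"

definition payoff ::
  "'a::euclidean_space set \<Rightarrow> ('a \<Rightarrow> real) \<Rightarrow> (nat \<Rightarrow> 'a \<times> real) \<Rightarrow> real" where
  "payoff \<Omega> u0 \<omega> =
     (let (x, t) = \<omega> (end_round \<Omega> \<omega>)
      in if t > 0 then 0 else if x \<in> \<Omega> then u0 x else 0)"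

definition expected_payoff ::
  "'a::euclidean_space set \<Rightarrow> real \<Rightarrow> ('a \<Rightarrow> real) \<Rightarrow> ('a \<times> real \<Rightarrow> real) \<Rightarrow> 'a \<Rightarrow> real \<Rightarrow> real" where
  "expected_payoff \<Omega> \<epsilon> u0 S x t = (\<integral>\<omega>. payoff \<Omega> u0 \<omega> \<partial>game_measure \<epsilon> S (x, t))"

definition game_value ::
  "'a::euclidean_space set \<Rightarrow> real \<Rightarrow> real \<Rightarrow> real \<Rightarrow> real \<Rightarrow> ('a \<Rightarrow> real) \<Rightarrow> 'a \<Rightarrow> real \<Rightarrow> real" where
  "game_value \<Omega> bm bp C \<epsilon> u0 x t = (INF S\<in>strategies bm bp C. expected_payoff \<Omega> \<epsilon> u0 S x t)"


section \<open>Well-definedness of the trajectory law\<close>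

lemma prob_space_uniform_ball:
  fixes x :: "'a::euclidean_space"
  assumes "0 < \<epsilon>"
  shows "prob_space (uniform_measure lborel (ball x \<epsilon>))"
proof (rule prob_space_uniform_measure)
  show "emeasure lborel (ball x \<epsilon>) \<noteq> 0"
    using content_ball_pos[OF assms, of x] by (auto simp: measure_def)
  show "emeasure lborel (ball x \<epsilon>) \<noteq> \<infinity>"
    using emeasure_bounded_finite[of "ball x \<epsilon>"] by auto
qed

lemma round_law_shift:
  fixes z :: "'a::euclidean_space \<times> real"
  shows "round_law \<epsilon> S z =
    distr (uniform_measure lborel (ball 0 \<epsilon>)) borel (\<lambda>y. (fst z + y, snd z - S z * \<epsilon>\<^sup>2))"
proof -
  have "uniform_measure lborel (ball (fst z) \<epsilon>) =
        distr (uniform_measure lborel (ball 0 \<epsilon>)) borel (\<lambda>y. fst z + y)" (is "?L = ?R")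
  proof (rule measure_eqI)
    fix A assume "A \<in> sets ?L"
    then have A[measurable]: "A \<in> sets borel" by simp
    have tr: "emeasure lborel B = emeasure lborel ((\<lambda>y. fst z + y) -` B)"
      if [measurable]: "B \<in> sets borel" for B :: "'a set"
      by (subst lborel_distr_plus[of "fst z", symmetric], subst emeasure_distr) auto
    have v: "(\<lambda>y. fst z + y) -` ball (fst z) \<epsilon> = ball 0 \<epsilon>"
      by (auto simp: dist_norm)
    show "emeasure ?L A = emeasure ?R A"
      using measurable_sets_borel[OF _ A, of "\<lambda>y. fst z + y"]
      by (simp add: emeasure_distr tr[of "ball (fst z) \<epsilon> \<inter> A"] tr[of "ball (fst z) \<epsilon>"] v
          vimage_Int)
  qed simp
  then show ?thesis
    by (simp add: round_law_def distr_distr comp_def)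
qed

lemma measurable_round_law:
  assumes "0 < \<epsilon>" and [measurable]: "S \<in> borel_measurable borel"
  shows "round_law \<epsilon> S \<in> measurable borel (subprob_algebra (borel :: ('a::euclidean_space \<times> real) measure))"
proof -
  interpret prob_space "uniform_measure lborel (ball (0::'a) \<epsilon>)"
    by (rule prob_space_uniform_ball) fact
  have "(\<lambda>z. distr (uniform_measure lborel (ball (0::'a) \<epsilon>)) borel
            (\<lambda>y. (fst z + y, snd z - S z * \<epsilon>\<^sup>2))) \<in> measurable borel (subprob_algebra borel)"
  proof (rule measurable_distr2)
    have [measurable]: "S \<in> borel_measurable (borel \<Otimes>\<^sub>M borel)"
      using assms(2) by (simp add: borel_prod)
    have "(\<lambda>p. (fst (fst p) + snd p, snd (fst p) - S (fst p) * \<epsilon>\<^sup>2)) \<in>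
        measurable ((borel \<Otimes>\<^sub>M borel) \<Otimes>\<^sub>M borel) (borel \<Otimes>\<^sub>M (borel :: real measure))"
      by measurable
    then show "(\<lambda>(z, y). (fst z + y, snd z - S z * \<epsilon>\<^sup>2)) \<in>
        measurable (borel \<Otimes>\<^sub>M (borel :: 'a measure)) borel"
      by (simp add: borel_prod case_prod_beta')
    show "(\<lambda>z. uniform_measure lborel (ball 0 \<epsilon>)) \<in>
        measurable borel (subprob_algebra (borel :: 'a measure))"
      by (intro measurable_const) (simp add: space_subprob_algebra subprob_space_axioms)
  qed
  then show ?thesis
    by (simp add: round_law_shift[abs_def])
qed

lemma Ionescu_Tulcea_game_kernel:
  fixes S :: "'a::euclidean_space \<times> real \<Rightarrow> real"
  assumes "0 < \<epsilon>" and "S \<in> borel_measurable borel"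
  shows "Ionescu_Tulcea (game_kernel \<epsilon> S z0) (\<lambda>_. borel)"
proof (rule Ionescu_Tulcea.intro)
  fix n
  show "game_kernel \<epsilon> S z0 n \<in> measurable (PiM {0..<n} (\<lambda>_. borel)) (subprob_algebra borel)"
  proof (cases n)
    case 0
    then show ?thesis
      by (auto simp: game_kernel_def[abs_def] space_subprob_algebra
          intro!: measurable_const prob_space_imp_subprob_space prob_space_return)
  next
    case (Suc k)
    have "(\<lambda>\<omega>. round_law \<epsilon> S (\<omega> k)) \<in> measurable (PiM {0..<n} (\<lambda>_. borel)) (subprob_algebra borel)"
      using Suc by (intro measurable_compose[OF _ measurable_round_law] assms
          measurable_component_singleton) auto
    then show ?thesis
      using Suc by (simp add: game_kernel_def[abs_def])
  qed
next
  fix n and \<omega> :: "nat \<Rightarrow> 'a \<times> real"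
  show "prob_space (game_kernel \<epsilon> S z0 n \<omega>)"
    using assms(1) by (auto simp: game_kernel_def round_law_def split: nat.split
        intro!: prob_space_return prob_space.prob_space_distr prob_space_uniform_ball
          borel_measurable_Pair)
qed

end

theory Submission
  imports Defs
begin

text \<open>
  Extend \<open>u\<close> to a function \<open>h\<close> on space-time, by \<open>0\<close> outside \<open>\<Omega>\<close> and by \<open>u0\<close> at nonpositive
  times. Along the trajectory stopped at the end of the game, the dynamic programming equation makes
  \<open>h\<close> a submartingale for every strategy, and a martingale if each round uses a \<open>\<beta>\<close> that attains
  the infimum. The game ends after boundedly many rounds and its payoff is the value of \<open>h\<close> at the end
  (\<open>payoff_telescope\<close>, \<open>terminal_AE\<close>). Hence the expected payoff is at least \<open>u x t\<close>
  (\<open>expected_payoff_ge\<close>), with equality for the optimal strategy (\<open>expected_payoff_optimal\<close>).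

  This needs \<open>h\<close> to be jointly measurable and the infimum to be attained by a measurable strategy,
  although no regularity of \<open>u\<close> is assumed. Both follow from a rigidity of the equation: with \<open>a\<close> and \<open>b\<close> the smallest and the largest time step, \<open>h\<close> depends on time only
  through the position of \<open>t\<close> relative to the discrete set of times \<open>i * a + j * b\<close> with \<open>i, j\<close>
  natural numbers (\<open>constant_between_grid\<close>). Hence the infimum at each time is a minimum over finitely
  many earlier times (\<open>dpp_Min\<close>), which come from a countable family of measurable selections. Picking
  the first minimiser gives a measurable strategy that is exactly optimal, so the infimum over
  strategies is attained.
\<close>

section \<open>One round under the law of the trajectory\<close>

lemma (in Ionescu_Tulcea) distr_lim_initial:
  "distr PF.lim (PiM {0..<n} M) (\<lambda>\<omega>. restrict \<omega> {0..<n}) = C 0 n (\<lambda>_. undefined)"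
proof (rule measure_eqI)
  show "sets (distr PF.lim (PiM {0..<n} M) (\<lambda>\<omega>. restrict \<omega> {0..<n})) = sets (C 0 n (\<lambda>_. undefined))"
    by (simp add: sets_C)
  fix A assume "A \<in> sets (distr PF.lim (PiM {0..<n} M) (\<lambda>\<omega>. restrict \<omega> {0..<n}))"
  then have A: "A \<in> sets (PiM {0..<n} M)" by simp
  have "emeasure (distr PF.lim (PiM {0..<n} M) (\<lambda>\<omega>. restrict \<omega> {0..<n})) A
      = emeasure PF.lim (PF.emb UNIV {0..<n} A)"
    using A by (subst emeasure_distr) (auto simp: prod_emb_def PF.space_lim space_PiM
        measurable_cong_sets[OF PF.sets_lim refl])
  also have "\<dots> = emeasure (C 0 n (\<lambda>_. undefined)) A"
    using A sets.sets_into_space[OF A]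
    by (simp add: lim emeasure_CI[OF order.refl] prod_emb_id space_PiM)
  finally show "emeasure (distr PF.lim (PiM {0..<n} M) (\<lambda>\<omega>. restrict \<omega> {0..<n})) A
      = emeasure (C 0 n (\<lambda>_. undefined)) A" .
qed

text \<open>Coordinate \<open>n\<close> can be integrated out first, against its conditional law given the
  coordinates before it. The restrictions make the arguments extensional functions, as the
  finite products require.\<close>

lemma (in Ionescu_Tulcea) nn_integral_lim_Suc:
  assumes f: "f \<in> borel_measurable (PiM {0..<Suc n} M)"
  shows "(\<integral>\<^sup>+\<omega>. f (restrict \<omega> {0..<Suc n}) \<partial>PF.lim) =
    (\<integral>\<^sup>+\<omega>. (\<integral>\<^sup>+z. f ((restrict \<omega> {0..<n})(n := z)) \<partial>P n (restrict \<omega> {0..<n})) \<partial>PF.lim)"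
proof -
  have restr: "(\<lambda>\<omega>. restrict \<omega> {0..<m}) \<in> measurable PF.lim (PiM {0..<m} M)" for m
    by (simp add: measurable_cong_sets[OF PF.sets_lim refl])
  have inner: "(\<lambda>\<omega>. \<integral>\<^sup>+z. f z \<partial>eP n \<omega>) \<in> borel_measurable (PiM {0..<n} M)"
    using f by measurable
  have "(\<integral>\<^sup>+\<omega>. f (restrict \<omega> {0..<Suc n}) \<partial>PF.lim) = (\<integral>\<^sup>+\<omega>. f \<omega> \<partial>C 0 (Suc n) (\<lambda>_. undefined))"
    using f restr by (subst distr_lim_initial[symmetric], subst nn_integral_distr) auto
  also have "\<dots> = (\<integral>\<^sup>+\<omega>. \<integral>\<^sup>+z. f z \<partial>eP n \<omega> \<partial>C 0 n (\<lambda>_. undefined))"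
    using f measurable_eP by (simp add: nn_integral_bind[where B="PiM {0..<Suc n} M"]
        measurable_cong_sets[OF sets_C refl])
  also have "\<dots> = (\<integral>\<^sup>+\<omega>. \<integral>\<^sup>+z. f z \<partial>eP n (restrict \<omega> {0..<n}) \<partial>PF.lim)"
    using inner restr by (subst distr_lim_initial[symmetric], subst nn_integral_distr) auto
  also have "\<dots> = (\<integral>\<^sup>+\<omega>. (\<integral>\<^sup>+z. f ((restrict \<omega> {0..<n})(n := z)) \<partial>P n (restrict \<omega> {0..<n})) \<partial>PF.lim)"
    using f measurable_space[OF restr] by (intro nn_integral_cong nn_integral_eP) auto
  finally show ?thesis .
qed

lemma sets_game_measure [measurable_cong]:
  assumes "0 < \<epsilon>" and "S \<in> borel_measurable borel"
  shows "sets (game_measure \<epsilon> S z0) = sets (PiM UNIV (\<lambda>_. borel))"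
proof -
  interpret Ionescu_Tulcea "game_kernel \<epsilon> S z0" "\<lambda>_. borel"
    by (rule Ionescu_Tulcea_game_kernel) fact+
  show ?thesis by (simp add: game_measure_def PF.sets_lim)
qed

lemma prob_space_game_measure:
  assumes "0 < \<epsilon>" and "S \<in> borel_measurable borel"
  shows "prob_space (game_measure \<epsilon> S z0)"
proof -
  interpret Ionescu_Tulcea "game_kernel \<epsilon> S z0" "\<lambda>_. borel"
    by (rule Ionescu_Tulcea_game_kernel) fact+
  have "emeasure PF.lim (space PF.lim) = 1"
  proof -
    have "space PF.lim = PF.emb UNIV {} {\<lambda>_. undefined}"
      by (auto simp: PF.space_lim space_PiM prod_emb_def restrict_def)
    then show ?thesis
      using lim[of "{}" "{\<lambda>_. undefined}"] prob_space.emeasure_space_1[OF PF.prob_space_P[of "{}"]]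
      by (simp add: PF.space_P space_PiM_empty sets_PiM_empty)
  qed
  then show ?thesis by (auto simp: game_measure_def intro: prob_spaceI)
qed

lemma prob_space_round_law: "0 < \<epsilon> \<Longrightarrow> prob_space (round_law \<epsilon> S z)"
  by (auto simp: round_law_def intro!: prob_space.prob_space_distr prob_space_uniform_ball)

lemma game_starts:
  fixes z0 :: "'a::euclidean_space \<times> real"
  assumes \<epsilon>: "0 < \<epsilon>" and S: "S \<in> borel_measurable borel"
  shows "AE \<omega> in game_measure \<epsilon> S z0. \<omega> 0 = z0"
proof -
  interpret Ionescu_Tulcea "game_kernel \<epsilon> S z0" "\<lambda>_. borel"
    by (rule Ionescu_Tulcea_game_kernel) fact+
  have m: "(\<lambda>\<omega>. indicator (- {z0}) (\<omega> 0) :: ennreal) \<in> borel_measurable (PiM {0..<Suc 0} (\<lambda>_. borel))"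
    by (intro measurable_compose[OF measurable_component_singleton]) auto
  have m': "(\<lambda>\<omega>. indicator (- {z0}) (\<omega> 0) :: ennreal) \<in> borel_measurable (game_measure \<epsilon> S z0)"
    unfolding measurable_cong_sets[OF sets_game_measure[OF assms] refl]
    by (intro measurable_compose[OF measurable_component_singleton]) auto
  have "(\<integral>\<^sup>+\<omega>. indicator (- {z0}) (\<omega> 0) \<partial>game_measure \<epsilon> S z0) = 0"
    using nn_integral_lim_Suc[OF m] by (simp add: game_measure_def game_kernel_def nn_integral_return)
  then have "AE \<omega> in game_measure \<epsilon> S z0. indicator (- {z0}) (\<omega> 0) = (0::ennreal)"
    by (subst (asm) nn_integral_0_iff_AE) (use m' in auto)
  then show ?thesis by (auto simp: indicator_def split: if_splits)
qed

text \<open>The Markov property of the game: conditionally on the history up to round \<open>n\<close>, the next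
  position has the law \<open>round_law\<close> at the current position. The assumption \<open>dep\<close> says that
  \<open>F\<close> depends on the history only through the positions \<open>0, \<dots>, n\<close>.\<close>

lemma nn_integral_game_step:
  fixes F :: "(nat \<Rightarrow> 'a::euclidean_space \<times> real) \<Rightarrow> 'a \<times> real \<Rightarrow> ennreal"
  assumes \<epsilon>: "0 < \<epsilon>" and S: "S \<in> borel_measurable borel"
    and F: "case_prod F \<in> borel_measurable (PiM {0..<Suc n} (\<lambda>_. borel) \<Otimes>\<^sub>M borel)"
    and dep: "\<And>\<omega> \<omega>' z. (\<And>i. i \<le> n \<Longrightarrow> \<omega> i = \<omega>' i) \<Longrightarrow> F \<omega> z = F \<omega>' z"
  shows "(\<integral>\<^sup>+\<omega>. F \<omega> (\<omega> (Suc n)) \<partial>game_measure \<epsilon> S z0) =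
    (\<integral>\<^sup>+\<omega>. (\<integral>\<^sup>+z. F \<omega> z \<partial>round_law \<epsilon> S (\<omega> n)) \<partial>game_measure \<epsilon> S z0)"
proof -
  interpret Ionescu_Tulcea "game_kernel \<epsilon> S z0" "\<lambda>_. borel"
    by (rule Ionescu_Tulcea_game_kernel) fact+
  have r: "F (restrict \<omega> {0..<Suc n}) z = F \<omega> z" for \<omega> z
    by (rule dep) auto
  have "(\<lambda>\<omega>. case_prod F (restrict \<omega> {0..<Suc n}, \<omega> (Suc n)))
      \<in> borel_measurable (PiM {0..<Suc (Suc n)} (\<lambda>_. borel))"
    by (intro measurable_compose[OF _ F] measurable_Pair measurable_restrict_subset
        measurable_component_singleton) auto
  then have m: "(\<lambda>\<omega>. F \<omega> (\<omega> (Suc n))) \<in> borel_measurable (PiM {0..<Suc (Suc n)} (\<lambda>_. borel))"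
    by (simp add: r)
  have d: "F (restrict \<omega> {0..<Suc (Suc n)}) z = F \<omega> z"
    "F (restrict (fun_upd \<omega> (Suc n) z') (insert (Suc n) {0..<Suc n})) z = F \<omega> z" for \<omega> z z'
    by (rule dep; simp)+
  show ?thesis
    using nn_integral_lim_Suc[OF m] by (simp add: game_measure_def game_kernel_def d)
qed

section \<open>Means over balls\<close>

lemma measurable_fst_borel: "fst \<in> (borel :: ('a::euclidean_space \<times> real) measure) \<rightarrow>\<^sub>M borel"
  and measurable_snd_borel: "snd \<in> (borel :: ('a::euclidean_space \<times> real) measure) \<rightarrow>\<^sub>M borel"
  by (simp_all flip: borel_prod)

text \<open>The mean of \<open>f\<close> over the ball of radius \<open>\<epsilon>\<close> around \<open>x\<close>, written as the quotient in the
  dynamic programming equation rather than as an integral over \<open>uniform_measure\<close>: for this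
  form, \<open>ball_mean_cong\<close> and the equation need no measurability of \<open>f\<close>.\<close>

definition ball_mean :: "real \<Rightarrow> ('a::euclidean_space \<Rightarrow> real) \<Rightarrow> 'a \<Rightarrow> real" where
  "ball_mean \<epsilon> f x = 1 / measure lborel (ball x \<epsilon>) * (LINT y:ball x \<epsilon>|lborel. f y)"

lemma ball_mean_cong:
  assumes "\<And>y. y \<in> ball x \<epsilon> \<Longrightarrow> f y = f' y"
  shows "ball_mean \<epsilon> f x = ball_mean \<epsilon> f' x"
  unfolding ball_mean_def set_lebesgue_integral_def using assms
  by (intro arg_cong2[where f="(*)"] Bochner_Integration.integral_cong) (auto split: split_indicator)

lemma integral_uniform_ball:
  fixes x :: "'a::euclidean_space"
  assumes "0 < \<epsilon>" and f: "f \<in> borel_measurable borel"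
  shows "(\<integral>y. f y \<partial>uniform_measure lborel (ball x \<epsilon>)) = ball_mean \<epsilon> f x"
proof -
  have pos: "0 < measure lborel (ball x \<epsilon>)"
    using content_ball_pos[OF assms(1), of x] by simp
  have em: "emeasure lborel (ball x \<epsilon>) = ennreal (measure lborel (ball x \<epsilon>))"
    by (intro emeasure_eq_ennreal_measure) (use emeasure_bounded_finite[of "ball x \<epsilon>"] in auto)
  have "uniform_measure lborel (ball x \<epsilon>)
      = density lborel (\<lambda>y. ennreal (indicator (ball x \<epsilon>) y / measure lborel (ball x \<epsilon>)))"
    unfolding uniform_measure_def em using pos
    by (intro arg_cong[where f="density lborel"] ext) (auto split: split_indicator simp: divide_ennreal[symmetric])
  then show ?thesis
    using f by (simp add: ball_mean_def set_lebesgue_integral_def, subst integral_density)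
      (auto intro!: borel_measurable_divide borel_measurable_indicator)
qed

lemma ball_mean_bound:
  fixes x :: "'a::euclidean_space"
  assumes "0 < \<epsilon>" and f: "f \<in> borel_measurable borel" and bd: "\<And>y. \<bar>f y\<bar> \<le> M"
  shows "\<bar>ball_mean \<epsilon> f x\<bar> \<le> M"
proof -
  interpret prob_space "uniform_measure lborel (ball x \<epsilon>)"
    by (rule prob_space_uniform_ball) fact
  have i: "integrable (uniform_measure lborel (ball x \<epsilon>)) f"
    using f bd by (intro integrable_const_bound[of _ M]) auto
  have "\<bar>\<integral>y. f y \<partial>uniform_measure lborel (ball x \<epsilon>)\<bar> \<le> (\<integral>y. \<bar>f y\<bar> \<partial>uniform_measure lborel (ball x \<epsilon>))"
    by (rule integral_abs_bound)
  also have "\<dots> \<le> M"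
    using i bd by (intro integral_le_const) auto
  finally show ?thesis
    using assms by (simp add: integral_uniform_ball)
qed

lemma integral_round_law:
  fixes z :: "'a::euclidean_space \<times> real"
  assumes "0 < \<epsilon>" and F: "F \<in> borel_measurable borel"
  shows "(\<integral>w. F w \<partial>round_law \<epsilon> S z) = ball_mean \<epsilon> (\<lambda>y. F (y, snd z - S z * \<epsilon>\<^sup>2)) (fst z)"
proof -
  have p: "(\<lambda>y. (y, snd z - S z * \<epsilon>\<^sup>2)) \<in> borel \<rightarrow>\<^sub>M (borel :: ('a \<times> real) measure)"
    by (intro borel_measurable_Pair) auto
  show ?thesis
    unfolding round_law_def
    using assms p measurable_compose[OF p F] by (subst integral_distr) (auto simp: integral_uniform_ball)
qed

lemma measurable_integral_round_law:
  fixes S :: "'a::euclidean_space \<times> real \<Rightarrow> real" and F :: "'a \<times> real \<Rightarrow> real"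
  assumes "0 < \<epsilon>" and "S \<in> borel_measurable borel" and "F \<in> borel_measurable borel"
  shows "(\<lambda>z. \<integral>w. F w \<partial>round_law \<epsilon> S z) \<in> borel_measurable borel"
  using measurable_round_law[OF assms(1,2)] integral_measurable_subprob_algebra[OF assms(3)]
  by (rule measurable_compose)

text \<open>Under the rule with constant value \<open>0\<close> the clock stands still, so the mean over a ball at a
  fixed time is an integral against \<open>round_law\<close>, whose measurability is known.\<close>

lemma measurable_ball_mean:
  fixes F :: "'a::euclidean_space \<times> real \<Rightarrow> real"
  assumes "0 < \<epsilon>" and "F \<in> borel_measurable borel"
  shows "(\<lambda>z. ball_mean \<epsilon> (\<lambda>y. F (y, snd z)) (fst z)) \<in> borel_measurable borel"
  using measurable_integral_round_law[OF assms(1) borel_measurable_const[of 0] assms(2)]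
  by (simp add: integral_round_law assms)

lemma measurable_ball_mean_slice:
  fixes f :: "'a::euclidean_space \<Rightarrow> real"
  assumes "0 < \<epsilon>" and f: "f \<in> borel_measurable borel"
  shows "ball_mean \<epsilon> f \<in> borel_measurable borel"
proof -
  have "(\<lambda>w::'a \<times> real. f (fst w)) \<in> borel_measurable borel"
    using f by (intro measurable_compose[OF _ f]) (auto simp flip: borel_prod)
  from measurable_ball_mean[OF assms(1) this]
  have "(\<lambda>z::'a \<times> real. ball_mean \<epsilon> f (fst z)) \<in> borel_measurable borel"
    by simp
  from measurable_compose[OF borel_measurable_Pair[of "\<lambda>x. x" borel "\<lambda>_. 0"] this] show ?thesis
    by simp
qed

section \<open>Solutions are step functions of time\<close>

text \<open>The dynamic programming equation with time steps between \<open>a = C b\<^sup>- \<epsilon>\<^sup>2\<close> and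
  \<open>b = C b\<^sup>+ \<epsilon>\<^sup>2\<close>. The function \<open>h\<close> is the solution, extended to all of space-time by \<open>0\<close>
  outside \<open>\<Omega>\<close> and by the initial datum \<open>g\<close> at all times \<open>t \<le> 0\<close>. Regularity is assumed at
  time \<open>0\<close> only.\<close>

locale dpp_game =
  fixes \<Omega> :: "'a::euclidean_space set" and a b \<epsilon> M :: real
    and g :: "'a \<Rightarrow> real" and h :: "'a \<times> real \<Rightarrow> real"
  assumes domain: "\<Omega> \<in> sets borel"
    and a_pos: "0 < a" and a_le_b: "a \<le> b" and eps_pos: "0 < \<epsilon>"
    and outside: "x \<notin> \<Omega> \<Longrightarrow> h (x, t) = 0"
    and initial: "x \<in> \<Omega> \<Longrightarrow> t \<le> 0 \<Longrightarrow> h (x, t) = g x"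
    and initial_measurable: "(\<lambda>x. h (x, 0)) \<in> borel_measurable borel"
    and initial_bound: "\<bar>h (x, 0)\<bar> \<le> M"
    and dpp: "x \<in> \<Omega> \<Longrightarrow> 0 < t \<Longrightarrow>
      h (x, t) = (INF s\<in>{t - b..t - a}. ball_mean \<epsilon> (\<lambda>y. h (y, s)) x)"
begin

text \<open>The times at which \<open>h\<close> can change: nonnegative integer combinations of \<open>a\<close> and \<open>b\<close>.\<close>

definition grid :: "real set" where
  "grid = range (\<lambda>(i::nat, j::nat). real i * a + real j * b)"

lemma countable_grid: "countable grid"
  by (simp add: grid_def)

lemma zero_in_grid: "0 \<in> grid"
  unfolding grid_def by (rule range_eqI[of _ _ "(0, 0)"]) simp

lemma grid_add:
  assumes "p \<in> grid"
  shows "p + a \<in> grid" and "p + b \<in> grid"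
proof -
  obtain i j :: nat where p: "p = real i * a + real j * b"
    using assms by (auto simp: grid_def)
  show "p + a \<in> grid"
    unfolding grid_def by (rule range_eqI[of _ _ "(Suc i, j)"]) (simp add: p algebra_simps)
  show "p + b \<in> grid"
    unfolding grid_def by (rule range_eqI[of _ _ "(i, Suc j)"]) (simp add: p algebra_simps)
qed

lemma grid_above: "\<exists>p\<in>grid. t \<le> p"
proof -
  obtain n :: nat where "t / a \<le> real n"
    using real_arch_simple by blast
  then have "t \<le> real n * a + real 0 * b"
    using a_pos by (simp add: field_simps)
  then show ?thesis
    unfolding grid_def by (intro bexI[OF _ range_eqI[of _ _ "(n, 0)"]]) auto
qed

lemma finite_grid: "finite (grid \<inter> {..t})"
proof -
  obtain n :: nat where n: "t / a \<le> real n"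
    using real_arch_simple by blast
  have "grid \<inter> {..t} \<subseteq> (\<lambda>(i::nat, j::nat). real i * a + real j * b) ` ({..n} \<times> {..n})"
  proof
    fix p assume "p \<in> grid \<inter> {..t}"
    then obtain i j :: nat where p: "p = real i * a + real j * b" "p \<le> t"
      by (auto simp: grid_def)
    have "real j * a \<le> real j * b" "0 \<le> real i * a" "0 \<le> real j * a"
      using a_pos a_le_b by (auto intro: mult_left_mono)
    moreover have "t \<le> real n * a"
      using n a_pos by (simp add: field_simps)
    ultimately have "real i * a \<le> real n * a" "real j * a \<le> real n * a"
      using p by linarith+
    then show "p \<in> (\<lambda>(i::nat, j::nat). real i * a + real j * b) ` ({..n} \<times> {..n})"
      using a_pos p by (intro rev_image_eqI[of "(i, j)"]) auto
  qed
  then show ?thesis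
    by (rule finite_subset) simp
qed

text \<open>If no grid point lies in \<open>[t, t')\<close>, then \<open>h\<close> takes the same values at the times \<open>t\<close> and
  \<open>t'\<close>. Since the grid is invariant under adding \<open>a\<close> and \<open>b\<close>, every time of the window
  \<open>[t - b, t - a]\<close> is, up to such an equivalence, a time of \<open>[t' - b, t' - a]\<close> and conversely,
  so both infima run over the same set of means. The induction is over slabs of height \<open>a\<close>.\<close>

lemma constant_between_grid:
  assumes "t \<le> t'" and "\<And>p. p \<in> grid \<Longrightarrow> t \<le> p \<Longrightarrow> t' \<le> p"
  shows "h (x, t) = h (x, t')"
proof -
  have "h (x, t) = h (x, t')"
    if "t' \<le> real n * a" "t \<le> t'" "\<forall>p\<in>grid. t \<le> p \<longrightarrow> t' \<le> p" for n x t t'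
    using that
  proof (induction n arbitrary: x t t')
    case 0
    then show ?case
      by (cases "x \<in> \<Omega>") (auto simp: initial outside)
  next
    case (Suc n)
    consider "x \<notin> \<Omega>" | "t' \<le> 0" "x \<in> \<Omega>" | "x \<in> \<Omega>" "0 < t'" by linarith
    then show ?case
    proof cases
      case 3
      have t: "0 < t"
        using Suc.prems(3) zero_in_grid 3(2) by force
      let ?m = "\<lambda>s. ball_mean \<epsilon> (\<lambda>y. h (y, s)) x"
      have le: "t' - a \<le> real n * a"
        using Suc.prems(1) by (simp add: algebra_simps)
      have "?m ` {t - b..t - a} = ?m ` {t' - b..t' - a}"
      proof (intro equalityI subsetI; elim imageE; hypsubst)
        fix s assume s: "s \<in> {t - b..t - a}"
        \<comment> \<open>Times left of the new window move up to its left end; the others stay.\<close>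
        have "?m s = ?m (max s (t' - b))"
        proof (cases "t' - b \<le> s")
          case False
          have "\<forall>p\<in>grid. s \<le> p \<longrightarrow> t' - b \<le> p"
            using Suc.prems(3) grid_add(2) s by force
          then have "h (y, s) = h (y, t' - b)" for y
            using False le a_le_b by (intro Suc.IH) auto
          with False show ?thesis by simp
        qed (simp add: max_def)
        moreover have "max s (t' - b) \<in> {t' - b..t' - a}"
          using s Suc.prems(2) a_le_b by auto
        ultimately show "?m s \<in> ?m ` {t' - b..t' - a}" by blast
      next
        fix s assume s: "s \<in> {t' - b..t' - a}"
        \<comment> \<open>Times right of the old window move down to its right end; the others stay.\<close>
        have "?m s = ?m (min s (t - a))"
        proof (cases "s \<le> t - a")
          case False
          have "\<forall>p\<in>grid. t - a \<le> p \<longrightarrow> s \<le> p"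
            using Suc.prems(3) grid_add(1) s by force
          then have "h (y, t - a) = h (y, s)" for y
            using False le s by (intro Suc.IH) auto
          with False show ?thesis by simp
        qed (simp add: min_def)
        moreover have "min s (t - a) \<in> {t - b..t - a}"
          using s Suc.prems(2) a_le_b by auto
        ultimately show "?m s \<in> ?m ` {t - b..t - a}" by blast
      qed
      then show ?thesis
        using dpp[OF 3(1) t] dpp[OF 3] by simp
    qed (use Suc.prems in \<open>auto simp: initial outside\<close>)
  qed
  moreover obtain n :: nat where "t' / a \<le> real n"
    using real_arch_simple by blast
  then have "t' \<le> real n * a"
    using a_pos by (simp add: field_simps)
  ultimately show ?thesis
    using assms by blast
qed

text \<open>The finitely many times that suffice in the infimum at time \<open>t\<close>. As \<open>h\<close> is constant
  between consecutive grid points \<open>p < q\<close> on the interval \<open>(p, q]\<close>, a time of the window may be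
  moved up to the next grid point, or to \<open>t - a\<close> if that comes first.\<close>

definition choices :: "real \<Rightarrow> real set" where
  "choices t = insert (t - a) (grid \<inter> {t - b..t - a})"

lemma finite_choices: "finite (choices t)"
  unfolding choices_def by (auto intro: finite_subset[OF _ finite_grid[of "t - a"]])

lemma choices_subset: "choices t \<subseteq> {t - b..t - a}"
  using a_le_b by (auto simp: choices_def)

lemma choices_suffice:
  assumes "s \<in> {t - b..t - a}"
  shows "\<exists>s'\<in>choices t. \<forall>y. h (y, s) = h (y, s')"
proof -
  let ?A = "grid \<inter> {s..t - a}"
  have fin: "finite ?A"
    by (auto intro: finite_subset[OF _ finite_grid[of "t - a"]])
  show ?thesis
  proof (cases "?A = {}")
    case True
    then have "h (y, s) = h (y, t - a)" for y
      using assms by (intro constant_between_grid) auto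
    then show ?thesis by (auto simp: choices_def)
  next
    case False
    have Min: "Min ?A \<in> ?A" using fin False by (rule Min_in)
    have "h (y, s) = h (y, Min ?A)" for y
    proof (rule constant_between_grid)
      show "s \<le> Min ?A" using Min by simp
      show "Min ?A \<le> p" if "p \<in> grid" "s \<le> p" for p
        using that Min fin by (cases "p \<le> t - a") auto
    qed
    moreover have "Min ?A \<in> choices t"
      using Min assms by (auto simp: choices_def)
    ultimately show ?thesis by blast
  qed
qed

lemma dpp_Min:
  assumes "x \<in> \<Omega>" "0 < t"
  shows "h (x, t) = Min ((\<lambda>s. ball_mean \<epsilon> (\<lambda>y. h (y, s)) x) ` choices t)"
proof -
  let ?m = "\<lambda>s. ball_mean \<epsilon> (\<lambda>y. h (y, s)) x"
  have "?m s \<in> ?m ` choices t" if s: "s \<in> {t - b..t - a}" for s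
  proof -
    obtain s' where "s' \<in> choices t" "\<forall>y. h (y, s) = h (y, s')"
      using choices_suffice[OF s] by blast
    then show ?thesis by (intro image_eqI[of _ _ s']) auto
  qed
  then have "?m ` {t - b..t - a} = ?m ` choices t"
    using choices_subset[of t] by auto
  then show ?thesis
    using dpp[OF assms] finite_choices[of t] by (simp add: choices_def cInf_eq_Min)
qed

lemma dpp_le:
  assumes "x \<in> \<Omega>" "0 < t" "s \<in> {t - b..t - a}"
  shows "h (x, t) \<le> ball_mean \<epsilon> (\<lambda>y. h (y, s)) x"
proof -
  obtain s' where s': "s' \<in> choices t" "\<forall>y. h (y, s) = h (y, s')"
    using choices_suffice[OF assms(3)] by blast
  then show ?thesis
    using dpp_Min[OF assms(1,2)] finite_choices by simp
qed

lemma dpp_attained: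
  assumes "x \<in> \<Omega>" "0 < t"
  shows "\<exists>s\<in>choices t. h (x, t) = ball_mean \<epsilon> (\<lambda>y. h (y, s)) x"
proof -
  have "h (x, t) \<in> (\<lambda>s. ball_mean \<epsilon> (\<lambda>y. h (y, s)) x) ` choices t"
    unfolding dpp_Min[OF assms]
    by (rule Min_in) (simp_all add: finite_choices, simp add: choices_def)
  then show ?thesis by blast
qed

text \<open>Spatial measurability and the bound are propagated together from slab to slab, since the
  bound on a mean needs the measurability of the integrand.\<close>

lemma
  shows measurable_slice: "(\<lambda>x. h (x, t)) \<in> borel_measurable borel"
    and bounded_slice: "\<bar>h (x, t)\<bar> \<le> M"
proof -
  have *: "(\<lambda>x. h (x, t)) \<in> borel_measurable borel \<and> (\<forall>x. \<bar>h (x, t)\<bar> \<le> M)"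
    if "t \<le> real n * a" for n t
    using that
  proof (induction n arbitrary: t)
    case 0
    then have "h (x, t) = h (x, 0)" for x
      by (cases "x \<in> \<Omega>") (auto simp: initial outside)
    then show ?case
      using initial_measurable initial_bound by simp
  next
    case (Suc n)
    show ?case
    proof (cases "t \<le> 0")
      case True
      then have "h (x, t) = h (x, 0)" for x
        by (cases "x \<in> \<Omega>") (auto simp: initial outside)
      then show ?thesis
        using initial_measurable initial_bound by simp
    next
      case False
      have IH: "(\<lambda>x. h (x, s)) \<in> borel_measurable borel" "\<bar>h (x, s)\<bar> \<le> M" if "s \<in> choices t" for s x
        using Suc.IH[of s] Suc.prems that choices_subset[of t] by (auto simp: algebra_simps)
      have eq: "(\<lambda>x. h (x, t)) = (\<lambda>x. if x \<in> \<Omega>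
          then Min ((\<lambda>s. ball_mean \<epsilon> (\<lambda>y. h (y, s)) x) ` choices t) else 0)"
        using False by (auto simp: dpp_Min outside)
      have "(\<lambda>x. h (x, t)) \<in> borel_measurable borel"
        unfolding eq using domain IH(1) eps_pos finite_choices
        by (intro measurable_If borel_measurable_Min measurable_ball_mean_slice) auto
      moreover have "\<bar>h (x, t)\<bar> \<le> M" for x
      proof (cases "x \<in> \<Omega>")
        case True
        then obtain s where "s \<in> choices t" "h (x, t) = ball_mean \<epsilon> (\<lambda>y. h (y, s)) x"
          using dpp_attained False by (meson not_le)
        then show ?thesis
          using ball_mean_bound[OF eps_pos IH(1,2)] by simp
      qed (use initial_bound[of x] in \<open>simp add: outside\<close>)
      ultimately show ?thesis by blast
    qed
  qed
  obtain n :: nat where "t / a \<le> real n"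
    using real_arch_simple by blast
  then have "t \<le> real n * a"
    using a_pos by (simp add: field_simps)
  from *[OF this] show "(\<lambda>x. h (x, t)) \<in> borel_measurable borel" "\<bar>h (x, t)\<bar> \<le> M"
    by auto
qed

lemma bounded_h: "\<bar>h z\<bar> \<le> M"
  using bounded_slice[of "fst z" "snd z"] by simp

section \<open>Joint measurability and an optimal strategy\<close>

abbreviation grid_enum :: "nat \<Rightarrow> real" where
  "grid_enum \<equiv> from_nat_into grid"

lemma range_grid_enum: "range grid_enum = grid"
  using zero_in_grid countable_grid by (intro range_from_nat_into) auto

text \<open>The index of the first grid point at or after \<open>t\<close>. Replacing \<open>t\<close> by this grid point does
  not change \<open>h\<close>, and it takes only countably many values, so measurability in the space variable
  at fixed times gives joint measurability.\<close>

definition next_index :: "real \<Rightarrow> nat" where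
  "next_index t = (LEAST n. t \<le> grid_enum n \<and> (\<forall>m. t \<le> grid_enum m \<longrightarrow> grid_enum n \<le> grid_enum m))"

lemma
  shows next_index_above: "t \<le> grid_enum (next_index t)"
    and next_index_least: "p \<in> grid \<Longrightarrow> t \<le> p \<Longrightarrow> grid_enum (next_index t) \<le> p"
proof -
  obtain q where q: "q \<in> grid" "t \<le> q"
    using grid_above by blast
  let ?A = "grid \<inter> {t..q}"
  have fin: "finite ?A"
    by (auto intro: finite_subset[OF _ finite_grid[of q]])
  have Min: "Min ?A \<in> ?A" using fin q by (intro Min_in) auto
  obtain n where n: "grid_enum n = Min ?A"
    using Min range_grid_enum by (metis IntD1 imageE)
  have le: "Min ?A \<le> p" if "p \<in> grid" "t \<le> p" for p
    using that Min fin by (cases "p \<le> q") auto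
  have "t \<le> grid_enum n \<and> (\<forall>m. t \<le> grid_enum m \<longrightarrow> grid_enum n \<le> grid_enum m)"
    using n Min le range_grid_enum by auto
  then have *: "t \<le> grid_enum (next_index t) \<and>
      (\<forall>m. t \<le> grid_enum m \<longrightarrow> grid_enum (next_index t) \<le> grid_enum m)"
    unfolding next_index_def by (rule LeastI)
  then show "t \<le> grid_enum (next_index t)" by blast
  show "grid_enum (next_index t) \<le> p" if "p \<in> grid" "t \<le> p"
    using that * range_grid_enum by (metis imageE)
qed

lemma measurable_h: "h \<in> borel_measurable borel"
proof -
  have idx: "next_index \<in> borel \<rightarrow>\<^sub>M count_space UNIV"
    unfolding next_index_def[abs_def] by measurable
  have "(\<lambda>z. (\<lambda>n z. h (fst z, grid_enum n)) (next_index (snd z)) z)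
      \<in> borel_measurable (borel \<Otimes>\<^sub>M (borel :: real measure))"
  proof (rule measurable_compose_countable)
    show "(\<lambda>z. h (fst z, grid_enum n)) \<in> borel_measurable (borel \<Otimes>\<^sub>M (borel :: real measure))" for n
      by (rule measurable_compose[OF measurable_fst measurable_slice])
    show "(\<lambda>z. next_index (snd z)) \<in> borel \<Otimes>\<^sub>M borel \<rightarrow>\<^sub>M count_space UNIV"
      by (rule measurable_compose[OF measurable_snd idx])
  qed
  moreover have "h (x, grid_enum (next_index t)) = h (x, t)" for x t
    by (rule constant_between_grid[symmetric, OF next_index_above next_index_least])
  then have "(\<lambda>z. h (fst z, grid_enum (next_index (snd z)))) = h"
    by (auto simp: fun_eq_iff)
  ultimately show ?thesis
    by (simp add: borel_prod)
qed

text \<open>The elements of \<open>choices t\<close>, enumerated by an index that does not depend on \<open>t\<close>. Grid points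
  outside the window are replaced by \<open>t - a\<close>, so that every index gives an admissible time.\<close>

definition candidate :: "nat \<Rightarrow> real \<Rightarrow> real" where
  "candidate n t = (if grid_enum n \<in> {t - b..t - a} then grid_enum n else t - a)"

lemma candidate_in: "candidate n t \<in> {t - b..t - a}"
  using a_le_b by (auto simp: candidate_def)

lemma choices_candidate:
  assumes "s \<in> choices t"
  shows "\<exists>n. s = candidate n t"
proof (cases "s \<in> grid \<inter> {t - b..t - a}")
  case True
  then obtain n where "s = grid_enum n"
    using range_grid_enum by (metis IntD1 imageE)
  with True show ?thesis by (auto simp: candidate_def)
next
  case False
  then have "s = t - a" using assms unfolding choices_def by blast
  moreover have "candidate (next_index t) t = t - a"
    using next_index_above[of t] a_pos by (auto simp: candidate_def)
  ultimately show ?thesis by metis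
qed

text \<open>The first index whose mean attains the infimum; it exists where the equation holds, and
  may be an unspecified number elsewhere.\<close>

definition best_index :: "'a \<times> real \<Rightarrow> nat" where
  "best_index z =
     (LEAST n. ball_mean \<epsilon> (\<lambda>y. h (y, candidate n (snd z))) (fst z) \<le> h z)"

text \<open>The strategy that moves the clock to the best candidate time. It is admissible everywhere,
  whatever the index is, by \<open>candidate_in\<close>.\<close>

definition optimal :: "'a \<times> real \<Rightarrow> real" where
  "optimal z = (snd z - candidate (best_index z) (snd z)) / \<epsilon>\<^sup>2"

lemma measurable_candidate: "candidate n \<in> borel_measurable borel"
  unfolding candidate_def[abs_def] atLeastAtMost_iff by measurable

lemma measurable_optimal: "optimal \<in> borel_measurable borel"
proof -
  have cand: "(\<lambda>z::'a \<times> real. candidate n (snd z)) \<in> borel_measurable borel" for n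
    by (rule measurable_compose[OF measurable_snd_borel measurable_candidate])
  have mean [measurable]: "(\<lambda>z. ball_mean \<epsilon> (\<lambda>y. h (y, candidate n (snd z))) (fst z))
      \<in> borel_measurable borel" for n
    using measurable_compose[OF borel_measurable_Pair[OF measurable_fst_borel cand]
        measurable_ball_mean[OF eps_pos measurable_h]] by simp
  note measurable_h [measurable]
  have "best_index \<in> borel \<rightarrow>\<^sub>M count_space UNIV"
    unfolding best_index_def[abs_def] by measurable
  then have "(\<lambda>z. (\<lambda>n z. candidate n (snd z)) (best_index z) z) \<in> borel_measurable borel"
    by (rule measurable_compose_countable[OF cand])
  then show ?thesis
    unfolding optimal_def[abs_def]
    by (intro borel_measurable_divide borel_measurable_diff measurable_snd_borel) auto
qed

lemma optimal_range: "optimal z * \<epsilon>\<^sup>2 \<in> {a..b}"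
  using candidate_in[of "best_index z" "snd z"] eps_pos by (auto simp: optimal_def)

lemma optimal_attains:
  assumes "fst z \<in> \<Omega>" "0 < snd z"
  shows "(\<integral>w. h w \<partial>round_law \<epsilon> optimal z) = h z"
proof -
  obtain s where "s \<in> choices (snd z)" "h z = ball_mean \<epsilon> (\<lambda>y. h (y, s)) (fst z)"
    using dpp_attained[OF assms] by auto
  then obtain n where "ball_mean \<epsilon> (\<lambda>y. h (y, candidate n (snd z))) (fst z) \<le> h z"
    using choices_candidate by (metis order_refl)
  then have "ball_mean \<epsilon> (\<lambda>y. h (y, candidate (best_index z) (snd z))) (fst z) \<le> h z"
    unfolding best_index_def by (rule LeastI)
  moreover have "h z \<le> ball_mean \<epsilon> (\<lambda>y. h (y, candidate (best_index z) (snd z))) (fst z)"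
    using dpp_le[OF assms candidate_in] by simp
  moreover have "(\<integral>w. h w \<partial>round_law \<epsilon> optimal z)
      = ball_mean \<epsilon> (\<lambda>y. h (y, candidate (best_index z) (snd z))) (fst z)"
    using eps_pos by (subst integral_round_law[OF eps_pos measurable_h]) (simp add: optimal_def)
  ultimately show ?thesis by simp
qed

lemma round_improves:
  assumes "fst z \<in> \<Omega>" "0 < snd z" "S z * \<epsilon>\<^sup>2 \<in> {a..b}"
  shows "h z \<le> (\<integral>w. h w \<partial>round_law \<epsilon> S z)"
  using dpp_le[OF assms(1,2), of "snd z - S z * \<epsilon>\<^sup>2"] assms(3)
  by (subst integral_round_law[OF eps_pos measurable_h]) auto

end

section \<open>The expected payoff\<close>

lemma measurable_position:
  fixes z0 :: "'a::euclidean_space \<times> real"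
  assumes "0 < \<epsilon>" and "S \<in> borel_measurable borel"
  shows "(\<lambda>\<omega>. \<omega> k) \<in> game_measure \<epsilon> S z0 \<rightarrow>\<^sub>M borel"
  unfolding measurable_cong_sets[OF sets_game_measure[OF assms] refl]
  by (rule measurable_component_singleton) simp

context dpp_game
begin

text \<open>The positions at which the game ends.\<close>

definition terminal :: "('a \<times> real) set" where
  "terminal = {z. (fst z \<notin> \<Omega> \<and> snd z > 0) \<or> snd z \<le> 0}"

lemma terminal_sets: "terminal \<in> sets borel"
proof -
  note domain [measurable] measurable_fst_borel [measurable] measurable_snd_borel [measurable]
  have "{z \<in> space borel. (fst z \<notin> \<Omega> \<and> snd z > 0) \<or> snd z \<le> 0} \<in> sets (borel :: ('a \<times> real) measure)"
    by measurable
  then show ?thesis by (simp add: terminal_def)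
qed

text \<open>The indicator that the game has not ended by round \<open>n\<close>.\<close>

definition running :: "nat \<Rightarrow> (nat \<Rightarrow> 'a \<times> real) \<Rightarrow> real" where
  "running n \<omega> = of_bool (\<forall>k\<le>n. \<omega> k \<notin> terminal)"

lemma measurable_running:
  assumes "\<And>k. k \<le> n \<Longrightarrow> (\<lambda>x. X x k) \<in> N \<rightarrow>\<^sub>M borel"
  shows "(\<lambda>x. running n (X x)) \<in> borel_measurable N"
proof -
  have "running n \<omega> = (\<Prod>k\<le>n. indicator (- terminal) (\<omega> k))" for \<omega>
    by (auto simp: running_def indicator_def intro!: prod.neutral[symmetric])
  moreover have "(\<lambda>x. indicator (- terminal) (X x k) :: real) \<in> borel_measurable N" if "k \<le> n" for k
    using terminal_sets by (intro measurable_compose[OF assms[OF that]] borel_measurable_indicator) auto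
  ultimately show ?thesis by simp
qed

text \<open>On the terminal set the payoff is the value of \<open>h\<close>, so along a trajectory that has ended by
  round \<open>N\<close> it is the initial value of \<open>h\<close> plus the increments made while the game was running.\<close>

lemma payoff_telescope:
  assumes "\<omega> N \<in> terminal"
  shows "payoff \<Omega> g \<omega> = h (\<omega> 0) + (\<Sum>n<N. running n \<omega> * (h (\<omega> (Suc n)) - h (\<omega> n)))"
proof -
  define \<tau> where "\<tau> = end_round \<Omega> \<omega>"
  have \<tau>: "\<tau> = (LEAST k. \<omega> k \<in> terminal)"
    by (simp add: \<tau>_def end_round_def terminal_def)
  have end_terminal: "\<omega> \<tau> \<in> terminal" and "\<tau> \<le> N"
    unfolding \<tau> using assms by (auto intro: LeastI Least_le)
  have running: "running n \<omega> = of_bool (n < \<tau>)" for n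
  proof -
    have "(\<forall>k\<le>n. \<omega> k \<notin> terminal) \<longleftrightarrow> n < \<tau>"
      using end_terminal not_less_Least[of _ "\<lambda>k. \<omega> k \<in> terminal", folded \<tau>]
      by (meson le_less_trans not_le)
    then show ?thesis by (simp add: running_def)
  qed
  have "h (\<omega> 0) + (\<Sum>n<m. running n \<omega> * (h (\<omega> (Suc n)) - h (\<omega> n))) = h (\<omega> (min m \<tau>))" for m
  proof (induction m)
    case (Suc m)
    then show ?case by (cases "m < \<tau>") (simp_all add: running min_def)
  qed simp
  then have "h (\<omega> 0) + (\<Sum>n<N. running n \<omega> * (h (\<omega> (Suc n)) - h (\<omega> n))) = h (\<omega> \<tau>)"
    using \<open>\<tau> \<le> N\<close> by (simp add: min_def)
  moreover have "payoff \<Omega> g \<omega> = h (\<omega> \<tau>)"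
    using end_terminal unfolding payoff_def \<tau>_def[symmetric]
    by (cases "\<omega> \<tau>") (auto simp: terminal_def initial outside)
  ultimately show ?thesis by simp
qed

text \<open>The game from the position \<open>z0\<close>, played with an admissible strategy \<open>S\<close>.\<close>

context
  fixes S :: "'a \<times> real \<Rightarrow> real" and z0 :: "'a \<times> real"
  assumes S_measurable: "S \<in> borel_measurable borel" and S_range: "S z * \<epsilon>\<^sup>2 \<in> {a..b}"
begin

abbreviation "G \<equiv> game_measure \<epsilon> S z0"

interpretation G: prob_space G
  using eps_pos S_measurable by (rule prob_space_game_measure)

lemmas position = measurable_position[OF eps_pos S_measurable, of _ z0]

lemma time_decreases: "AE \<omega> in G. snd (\<omega> (Suc n)) \<le> snd (\<omega> n) - a"
proof -
  let ?F = "\<lambda>\<omega> z. indicator {w. snd (\<omega> n) - a < snd w} z :: ennreal"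
  note measurable_snd_borel [measurable] position [measurable]
  let ?N = "PiM {0..<Suc n} (\<lambda>_. borel :: ('a \<times> real) measure) \<Otimes>\<^sub>M (borel :: ('a \<times> real) measure)"
  have [measurable]: "(\<lambda>p. snd (fst p n)) \<in> borel_measurable ?N" "(\<lambda>p. snd (snd p)) \<in> borel_measurable ?N"
    by (auto intro!: measurable_compose[OF _ measurable_snd_borel]
        measurable_compose[OF measurable_fst measurable_component_singleton])
  have F: "case_prod ?F \<in> borel_measurable ?N"
    unfolding case_prod_beta' indicator_def mem_Collect_eq by measurable
  have zero: "(\<integral>\<^sup>+z. ?F \<omega> z \<partial>round_law \<epsilon> S (\<omega> n)) = 0" for \<omega>
  proof -
    have "{w. snd (\<omega> n) - a < snd w} \<in> sets (borel :: ('a \<times> real) measure)"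
      by measurable
    moreover have "(\<lambda>y. (y, snd (\<omega> n) - S (\<omega> n) * \<epsilon>\<^sup>2)) \<in> borel \<rightarrow>\<^sub>M (borel :: ('a \<times> real) measure)"
      by (intro borel_measurable_Pair) auto
    ultimately show ?thesis
      unfolding round_law_def using S_range[of "\<omega> n"] by (subst nn_integral_distr) auto
  qed
  from F have "(\<integral>\<^sup>+\<omega>. ?F \<omega> (\<omega> (Suc n)) \<partial>G) = (\<integral>\<^sup>+\<omega>. \<integral>\<^sup>+z. ?F \<omega> z \<partial>round_law \<epsilon> S (\<omega> n) \<partial>G)"
    by (intro nn_integral_game_step eps_pos S_measurable) auto
  also have "\<dots> = 0" by (simp only: zero) simp
  finally have "(\<integral>\<^sup>+\<omega>. ?F \<omega> (\<omega> (Suc n)) \<partial>G) = 0" .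
  moreover have "(\<lambda>\<omega>. ?F \<omega> (\<omega> (Suc n))) \<in> borel_measurable G"
    unfolding indicator_def mem_Collect_eq by measurable
  ultimately have "AE \<omega> in G. ?F \<omega> (\<omega> (Suc n)) = 0"
    by (simp add: nn_integral_0_iff_AE)
  then show ?thesis
    by (auto simp: indicator_def not_less split: if_splits)
qed

text \<open>Almost surely every round lowers the clock by at least \<open>a\<close>, so the game ends after a
  bounded number of rounds.\<close>

lemma terminal_AE:
  assumes "snd z0 \<le> real N * a"
  shows "AE \<omega> in G. \<omega> N \<in> terminal"
proof -
  have "AE \<omega> in G. \<forall>n. snd (\<omega> (Suc n)) \<le> snd (\<omega> n) - a"
    using time_decreases by (subst AE_all_countable) auto
  then show ?thesis
    using game_starts[OF eps_pos S_measurable, of z0]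
  proof eventually_elim
    case (elim \<omega>)
    have "snd (\<omega> n) \<le> snd z0 - real n * a" for n
    proof (induction n)
      case (Suc n)
      then show ?case using elim(1)[rule_format, of n] by (simp add: algebra_simps)
    qed (use elim in simp)
    from this[of N] show ?case using assms by (simp add: terminal_def)
  qed
qed

lemma measurable_running_game: "running n \<in> borel_measurable G"
  by (rule measurable_running[OF position])

lemma measurable_payoff: "payoff \<Omega> g \<in> borel_measurable G"
proof -
  note terminal_sets [measurable] position [measurable] measurable_snd_borel [measurable] measurable_h [measurable]
  have end_round: "end_round \<Omega> = (\<lambda>\<omega>. LEAST k. \<omega> k \<in> terminal)"
    by (simp add: end_round_def terminal_def fun_eq_iff)
  have "end_round \<Omega> \<in> G \<rightarrow>\<^sub>M count_space UNIV"
    unfolding end_round by measurable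
  moreover have "(\<lambda>\<omega>. if snd (\<omega> k) > 0 then 0 else h (\<omega> k)) \<in> borel_measurable G" for k
    by measurable
  ultimately have "(\<lambda>\<omega>. (\<lambda>k \<omega>. if snd (\<omega> k) > 0 then 0 else h (\<omega> k)) (end_round \<Omega> \<omega>) \<omega>) \<in> borel_measurable G"
    by (rule measurable_compose_countable[rotated])
  \<comment> \<open>This holds on every trajectory, also where the game never ends and \<open>end_round\<close> is unspecified.\<close>
  moreover have "payoff \<Omega> g = (\<lambda>\<omega>. if snd (\<omega> (end_round \<Omega> \<omega>)) > 0 then 0 else h (\<omega> (end_round \<Omega> \<omega>)))"
  proof
    fix \<omega>
    show "payoff \<Omega> g \<omega> = (if snd (\<omega> (end_round \<Omega> \<omega>)) > 0 then 0 else h (\<omega> (end_round \<Omega> \<omega>)))"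
      by (cases "\<omega> (end_round \<Omega> \<omega>)") (auto simp: payoff_def initial outside)
  qed
  ultimately show ?thesis by simp
qed

lemma round_mean_bound: "\<bar>\<integral>w. h w \<partial>round_law \<epsilon> S z\<bar> \<le> M"
  by (subst integral_round_law[OF eps_pos measurable_h])
    (intro ball_mean_bound eps_pos measurable_slice bounded_slice)

lemma integrable_running:
  assumes "F \<in> borel_measurable borel" "\<And>z. \<bar>F z\<bar> \<le> K"
  shows "integrable G (\<lambda>\<omega>. running n \<omega> * F (\<omega> k))"
proof (rule G.integrable_const_bound[of _ K])
  show "(\<lambda>\<omega>. running n \<omega> * F (\<omega> k)) \<in> borel_measurable G"
    using measurable_running_game measurable_compose[OF position assms(1)] by (rule borel_measurable_times)
  have "0 \<le> K" using assms(2)[of z0] by linarith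
  then show "AE \<omega> in G. norm (running n \<omega> * F (\<omega> k)) \<le> K"
    using assms(2) by (auto simp: running_def)
qed

text \<open>In expectation the next value of \<open>h\<close> may be replaced by its conditional mean. The constant
  \<open>M\<close> is added to make the integrands nonnegative.\<close>

lemma expected_increment:
  "(\<integral>\<omega>. running n \<omega> * (h (\<omega> (Suc n)) - h (\<omega> n)) \<partial>G) =
   (\<integral>\<omega>. running n \<omega> * ((\<integral>w. h w \<partial>round_law \<epsilon> S (\<omega> n)) - h (\<omega> n)) \<partial>G)"
proof -
  let ?H = "\<lambda>z. \<integral>w. h w \<partial>round_law \<epsilon> S z"
  have H: "?H \<in> borel_measurable borel"
    by (rule measurable_integral_round_law[OF eps_pos S_measurable measurable_h])
  have int: "integrable (round_law \<epsilon> S z) h" for z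
  proof -
    interpret prob_space "round_law \<epsilon> S z"
      by (rule prob_space_round_law[OF eps_pos])
    show ?thesis
      using measurable_h bounded_h
      by (intro integrable_const_bound[of _ M]) (auto simp: round_law_def)
  qed
  let ?F = "\<lambda>\<omega> z. ennreal (running n \<omega> * (h z + M))"
  have nonneg: "0 \<le> h z + M" "0 \<le> ?H z + M" for z
    using bounded_h[of z] round_mean_bound[of z] by auto
  have running_nonneg: "0 \<le> running n \<omega>" for \<omega>
    by (simp add: running_def)
  have m: "(\<lambda>\<omega>. running n \<omega> * (h (\<omega> (Suc n)) + M)) \<in> borel_measurable G"
    "(\<lambda>\<omega>. running n \<omega> * (?H (\<omega> n) + M)) \<in> borel_measurable G"
    by (intro borel_measurable_times borel_measurable_add borel_measurable_const measurable_running_game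
        measurable_compose[OF position measurable_h] measurable_compose[OF position H])+
  have F: "case_prod ?F \<in> borel_measurable (PiM {0..<Suc n} (\<lambda>_. borel) \<Otimes>\<^sub>M borel)"
    unfolding case_prod_beta'
    by (intro measurable_compose[OF _ measurable_ennreal] borel_measurable_times borel_measurable_add
        borel_measurable_const measurable_compose[OF measurable_snd measurable_h] measurable_running
        measurable_compose[OF measurable_fst measurable_component_singleton]) auto
  have "(\<integral>\<^sup>+\<omega>. ?F \<omega> (\<omega> (Suc n)) \<partial>G) = (\<integral>\<^sup>+\<omega>. \<integral>\<^sup>+z. ?F \<omega> z \<partial>round_law \<epsilon> S (\<omega> n) \<partial>G)"
    by (intro nn_integral_game_step eps_pos S_measurable F) (simp add: running_def)
  also have "\<dots> = (\<integral>\<^sup>+\<omega>. ennreal (running n \<omega> * (?H (\<omega> n) + M)) \<partial>G)"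
  proof (rule nn_integral_cong)
    fix \<omega>
    interpret prob_space "round_law \<epsilon> S (\<omega> n)"
      by (rule prob_space_round_law[OF eps_pos])
    have "(\<integral>\<^sup>+z. ?F \<omega> z \<partial>round_law \<epsilon> S (\<omega> n)) = ennreal (\<integral>z. running n \<omega> * (h z + M) \<partial>round_law \<epsilon> S (\<omega> n))"
      using int nonneg by (intro nn_integral_eq_integral) (auto simp: running_def)
    also have "(\<integral>z. running n \<omega> * (h z + M) \<partial>round_law \<epsilon> S (\<omega> n)) = running n \<omega> * (?H (\<omega> n) + M)"
      using int by (simp add: prob_space)
    finally show "(\<integral>\<^sup>+z. ?F \<omega> z \<partial>round_law \<epsilon> S (\<omega> n)) = ennreal (running n \<omega> * (?H (\<omega> n) + M))" .
  qed
  finally have "(\<integral>\<omega>. running n \<omega> * (h (\<omega> (Suc n)) + M) \<partial>G) = (\<integral>\<omega>. running n \<omega> * (?H (\<omega> n) + M) \<partial>G)"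
    by (simp add: integral_eq_nn_integral m nonneg running_nonneg)
  moreover have "integrable G (\<lambda>\<omega>. running n \<omega> * h (\<omega> (Suc n)))" "integrable G (\<lambda>\<omega>. running n \<omega> * h (\<omega> n))"
    by (rule integrable_running[OF measurable_h bounded_h])+
  moreover have "integrable G (\<lambda>\<omega>. running n \<omega> * ?H (\<omega> n))"
    by (rule integrable_running[OF H round_mean_bound])
  moreover have "integrable G (\<lambda>\<omega>. running n \<omega> * M)"
    by (rule integrable_running[of "\<lambda>_. M" "\<bar>M\<bar>"]) auto
  ultimately show ?thesis
    by (simp add: distrib_left right_diff_distrib)
qed

lemma expected_payoff_eq:
  assumes "snd z0 \<le> real N * a"
  shows "(\<integral>\<omega>. payoff \<Omega> g \<omega> \<partial>G) = h z0 +
    (\<Sum>n<N. \<integral>\<omega>. running n \<omega> * ((\<integral>w. h w \<partial>round_law \<epsilon> S (\<omega> n)) - h (\<omega> n)) \<partial>G)"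
proof -
  let ?D = "\<lambda>n \<omega>. running n \<omega> * (h (\<omega> (Suc n)) - h (\<omega> n))"
  have int: "integrable G (?D n)" for n
    using integrable_running[OF measurable_h bounded_h, of n]
    by (simp add: right_diff_distrib)
  have eq: "AE \<omega> in G. payoff \<Omega> g \<omega> = h z0 + (\<Sum>n<N. ?D n \<omega>)"
    using terminal_AE[OF assms] game_starts[OF eps_pos S_measurable, of z0]
    by eventually_elim (simp add: payoff_telescope)
  have sum_int: "integrable G (\<lambda>\<omega>. h z0 + (\<Sum>n<N. ?D n \<omega>))"
    using int by auto
  have "(\<integral>\<omega>. payoff \<Omega> g \<omega> \<partial>G) = (\<integral>\<omega>. h z0 + (\<Sum>n<N. ?D n \<omega>) \<partial>G)"
    using eq measurable_payoff sum_int by (intro integral_cong_AE) auto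
  also have "\<dots> = h z0 + (\<Sum>n<N. \<integral>\<omega>. ?D n \<omega> \<partial>G)"
    using int by (simp add: G.prob_space)
  finally show ?thesis
    by (simp add: expected_increment)
qed

end

text \<open>By the dynamic programming equation all conditional increments are nonnegative under an
  admissible strategy, and they vanish under the optimal one.\<close>

lemma expected_payoff_ge:
  assumes "S \<in> borel_measurable borel" "\<And>z. S z * \<epsilon>\<^sup>2 \<in> {a..b}"
  shows "h (x, t) \<le> expected_payoff \<Omega> \<epsilon> g S x t"
proof -
  obtain N :: nat where "t / a \<le> real N"
    using real_arch_simple by blast
  then have N: "snd (x, t) \<le> real N * a"
    using a_pos by (simp add: field_simps)
  have "0 \<le> running n \<omega> * ((\<integral>w. h w \<partial>round_law \<epsilon> S (\<omega> n)) - h (\<omega> n))" for n \<omega>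
    using round_improves[OF _ _ assms(2), of "\<omega> n"] by (auto simp: running_def terminal_def not_le)
  then show ?thesis
    unfolding expected_payoff_def expected_payoff_eq[OF assms N]
    by (simp add: sum_nonneg)
qed

lemma expected_payoff_optimal: "expected_payoff \<Omega> \<epsilon> g optimal x t = h (x, t)"
proof -
  obtain N :: nat where "t / a \<le> real N"
    using real_arch_simple by blast
  then have N: "snd (x, t) \<le> real N * a"
    using a_pos by (simp add: field_simps)
  have "running n \<omega> * ((\<integral>w. h w \<partial>round_law \<epsilon> optimal (\<omega> n)) - h (\<omega> n)) = 0" for n \<omega>
    using optimal_attains[of "\<omega> n"] by (auto simp: running_def terminal_def not_le)
  then show ?thesis
    unfolding expected_payoff_def expected_payoff_eq[OF measurable_optimal optimal_range N]
    by (simp only:) simp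
qed

end

section \<open>The value of the game\<close>

theorem lemma5p3:
  fixes \<Omega> :: "'a::euclidean_space set"
    and bm bp C \<epsilon> :: real
    and u0 :: "'a \<Rightarrow> real"
    and u :: "'a \<Rightarrow> real \<Rightarrow> real"
  assumes "bounded_smooth_domain \<Omega>"
    and "0 < bm" and "bm < bp" and "0 < \<epsilon>" and "0 < C"
    and "continuous_on (closure \<Omega>) u0"
    and "\<forall>x\<in>frontier \<Omega>. u0 x = 0"
    and "DPP_solution \<Omega> bm bp C \<epsilon> u0 u"
  shows "\<forall>x\<in>\<Omega>. \<forall>t>0. u x t = game_value \<Omega> bm bp C \<epsilon> u0 x t"
proof -
  define h where "h = (\<lambda>(x, t). if x \<in> \<Omega> then if 0 < t then u x t else u0 x else 0)"
  define a b where "a = C * bm * \<epsilon>\<^sup>2" and "b = C * bp * \<epsilon>\<^sup>2"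
  have ab: "0 < a" "a \<le> b"
    using assms(2-5) by (simp_all add: a_def b_def)
  have open_\<Omega>: "open \<Omega>" and "bounded \<Omega>"
    using assms(1) by (auto simp: bounded_smooth_domain_def)
  then have "compact (u0 ` closure \<Omega>)"
    using assms(6) by (intro compact_continuous_image) (auto simp: compact_closure)
  then obtain M where M: "\<forall>x\<in>closure \<Omega>. \<bar>u0 x\<bar> \<le> M"
    by (auto dest!: compact_imp_bounded simp: bounded_iff)
  have dpp: "u x t = (INF \<beta>\<in>{C * bm..C * bp}. ball_mean \<epsilon> (\<lambda>y. u y (t - \<beta> * \<epsilon>\<^sup>2)) x)"
    if "x \<in> \<Omega>" "0 < t" for x t
    using assms(8) that by (simp add: DPP_solution_def ball_mean_def)
  have u_eq_h: "u y s = h (y, s)" if "x \<in> \<Omega>" "y \<in> ball x \<epsilon>" "- b < s" for x y s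
  proof (cases "y \<in> \<Omega>")
    case False
    have "y = x + (y - x)" "y - x \<in> ball 0 \<epsilon>"
      using that by (auto simp: dist_norm norm_minus_commute)
    then have "y \<in> outer_strip \<Omega> \<epsilon>"
      unfolding outer_strip_def using that(1) False by blast
    then show ?thesis
      using assms(8) that(3) False by (simp add: DPP_solution_def h_def b_def)
  qed (use assms(8) that in \<open>auto simp: DPP_solution_def h_def b_def not_less\<close>)
  interpret dpp_game \<Omega> a b \<epsilon> "\<bar>M\<bar>" u0 h
  proof
    show "\<Omega> \<in> sets borel" using open_\<Omega> by simp
    show "(\<lambda>x. h (x, 0)) \<in> borel_measurable borel"
    proof -
      have "(\<lambda>x. indicator \<Omega> x *\<^sub>R u0 x) \<in> borel_measurable borel"
        using open_\<Omega> continuous_on_subset[OF assms(6) closure_subset]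
        by (intro borel_measurable_continuous_on_indicator) auto
      also have "(\<lambda>x. indicator \<Omega> x *\<^sub>R u0 x) = (\<lambda>x. h (x, 0))"
        by (auto simp: h_def indicator_def)
      finally show ?thesis .
    qed
    show "\<bar>h (x, 0)\<bar> \<le> \<bar>M\<bar>" for x
      using M closure_subset[of \<Omega>] by (force simp: h_def)
    \<comment> \<open>The substitution \<open>s = t - \<beta> \<epsilon>\<^sup>2\<close>.\<close>
    show "h (x, t) = (INF s\<in>{t - b..t - a}. ball_mean \<epsilon> (\<lambda>y. h (y, s)) x)"
      if "x \<in> \<Omega>" "0 < t" for x t
    proof -
      have window: "(\<lambda>\<beta>. t - \<beta> * \<epsilon>\<^sup>2) ` {C * bm..C * bp} = {t - b..t - a}"
      proof (intro equalityI subsetI)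
        fix s assume "s \<in> {t - b..t - a}"
        then show "s \<in> (\<lambda>\<beta>. t - \<beta> * \<epsilon>\<^sup>2) ` {C * bm..C * bp}"
          using assms(4) by (intro image_eqI[of _ _ "(t - s) / \<epsilon>\<^sup>2"]) (auto simp: a_def b_def field_simps)
      qed (use assms(4) in \<open>auto simp: a_def b_def mult_right_mono\<close>)
      have "(\<lambda>s. ball_mean \<epsilon> (\<lambda>y. h (y, s)) x) ` {t - b..t - a}
          = (\<lambda>\<beta>. ball_mean \<epsilon> (\<lambda>y. h (y, t - \<beta> * \<epsilon>\<^sup>2)) x) ` {C * bm..C * bp}"
        by (simp add: window[symmetric] image_image)
      moreover have "ball_mean \<epsilon> (\<lambda>y. u y (t - \<beta> * \<epsilon>\<^sup>2)) x = ball_mean \<epsilon> (\<lambda>y. h (y, t - \<beta> * \<epsilon>\<^sup>2)) x"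
        if "\<beta> \<in> {C * bm..C * bp}" for \<beta>
      proof -
        have "\<beta> * \<epsilon>\<^sup>2 \<le> b"
          using that by (simp add: b_def mult_right_mono)
        then show ?thesis
          using \<open>x \<in> \<Omega>\<close> \<open>0 < t\<close> by (intro ball_mean_cong u_eq_h) auto
      qed
      moreover have "h (x, t) = u x t"
        using that by (simp add: h_def)
      ultimately show ?thesis
        using dpp[OF that] by (simp cong: image_cong_simp)
    qed
  qed (use ab assms(4) in \<open>auto simp: h_def\<close>)
  show ?thesis
  proof (intro ballI allI impI)
    fix x t assume x: "x \<in> \<Omega>" and t: "0 < (t::real)"
    have strat: "S \<in> strategies bm bp C \<longleftrightarrow> S \<in> borel_measurable borel \<and> (\<forall>z. S z * \<epsilon>\<^sup>2 \<in> {a..b})"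
      for S :: "'a \<times> real \<Rightarrow> real"
      using assms(4) by (simp add: strategies_def a_def b_def)
    have "game_value \<Omega> bm bp C \<epsilon> u0 x t = h (x, t)"
      unfolding game_value_def
    proof (rule cInf_eq_minimum)
      show "h (x, t) \<in> (\<lambda>S. expected_payoff \<Omega> \<epsilon> u0 S x t) ` strategies bm bp C"
        using measurable_optimal optimal_range strat
        by (intro image_eqI[of _ _ optimal]) (simp_all add: expected_payoff_optimal)
    qed (use expected_payoff_ge strat in blast)
    then show "u x t = game_value \<Omega> bm bp C \<epsilon> u0 x t"
      using x t by (simp add: h_def)
  qed
qed

end
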